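(* Let $L$ be a finite-dimensional Lie algebra over a field $F$. If $x\in L$ and $F$ is a finite field with $|F|=q$, then $q$ divides $|\mathrm{sol}_L(x)|$.
   Context: For elements $x,y$ of a Lie algebra $L$, $\langle x,y\rangle$ denotes the Lie subalgebra generated by $x$ and $y$. For $x\in L$, the solvabilizer of $x$ in $L$ is $\mathrm{sol}_L(x)=\{y\in L\mid \langle x,y\rangle \text{ is a solvable Lie subalgebra of } L\}$.
   Formalization: The formal statement additionally assumes that L is nonzero; for L = 0 the claim fails, since sol_L(0) = {0} has one element and q ≥ 2 does not divide 1. *)

theory Defs
  imports Main "HOL.Vector_Spaces"
begin

locale lie_algebra = vector_space scale
  for scale :: "'f::field \<Rightarrow> 'a::ab_group_add \<Rightarrow> 'a" (infixr \<open>*s\<close> 75) +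
  fixes bracket :: "'a \<Rightarrow> 'a \<Rightarrow> 'a"
  assumes bracket_linear_left: "Vector_Spaces.linear scale scale (\<lambda>a. bracket a b)"
    and bracket_linear_right: "Vector_Spaces.linear scale scale (\<lambda>b. bracket a b)"
    and bracket_alternating: "bracket a a = 0"
    and jacobi: "bracket a (bracket b c) + bracket b (bracket c a) + bracket c (bracket a b) = 0"
begin

definition lie_subalgebra :: "'a set \<Rightarrow> bool" where
  "lie_subalgebra H \<longleftrightarrow> subspace H \<and> (\<forall>a\<in>H. \<forall>b\<in>H. bracket a b \<in> H)"

definition generated_subalgebra :: "'a set \<Rightarrow> 'a set" where
  "generated_subalgebra S = lie_subalgebra hull S"

definition derived_subalgebra :: "'a set \<Rightarrow> 'a set" where
  "derived_subalgebra H = span {bracket a b | a b. a \<in> H \<and> b \<in> H}"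

definition solvable_subalgebra :: "'a set \<Rightarrow> bool" where
  "solvable_subalgebra H \<longleftrightarrow> lie_subalgebra H \<and> (\<exists>n. (derived_subalgebra ^^ n) H = {0})"

definition solvabilizer :: "'a \<Rightarrow> 'a set" where
  "solvabilizer x = {y. solvable_subalgebra (generated_subalgebra {x, y})}"

end

end

theory Submission
  imports Defs
begin

text \<open>If \<open>x \<noteq> 0\<close>, the subalgebra generated by \<open>x\<close> and \<open>y\<close> does not change when a multiple of \<open>x\<close>
  is added to \<open>y\<close>, so the solvabilizer of \<open>x\<close> is a union of cosets of the line \<open>F x\<close>. If \<open>x = 0\<close>,
  the solvabilizer is all of \<open>L\<close>, a union of cosets of any line.\<close>

text \<open>The cosets of the line through \<open>v\<close> partition \<open>S\<close>, and each has
  as many elements as the field. In \<open>vector_space\<close>, \<open>'a\<close> is the type of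
  scalars.\<close>

lemma (in vector_space) card_field_dvd_card_translation_invariant:
  assumes "v \<noteq> 0" and inv: "\<And>y c. y \<in> S \<Longrightarrow> y + c *s v \<in> S"
  shows "card (UNIV :: 'a set) dvd card S"
proof (cases "finite S")
  case True
  define coset where "coset y = range (\<lambda>c. y + c *s v)" for y
  have mem: "y \<in> coset y" for y
    unfolding coset_def by (rule range_eqI[where x = 0]) simp
  have coset_eq: "coset z = coset y" if z: "z \<in> coset y" for y z
  proof -
    from z obtain d where d: "z = y + d *s v" by (auto simp: coset_def)
    \<comment> \<open>Moving the base point from \<open>y\<close> to \<open>z\<close> only shifts
      the parameter by \<open>d\<close>; the two shifts give the two inclusions.\<close>
    have "z + c *s v = y + (d + c) *s v" for c
      by (simp add: d scale_left_distrib add.assoc)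
    moreover have "y + c *s v = z + (c - d) *s v" for c
      by (simp add: d scale_left_diff_distrib)
    ultimately show ?thesis
      unfolding coset_def by (intro subset_antisym image_subsetI) (metis rangeI)+
  qed
  have union: "\<Union> (coset ` S) = S"
    using inv mem by (auto simp: coset_def)
  have "card (UNIV :: 'a set) dvd card (\<Union> (coset ` S))"
  proof (rule dvd_partition)
    show "finite (\<Union> (coset ` S))"
      using True union by simp
    show "\<forall>C\<in>coset ` S. card (UNIV :: 'a set) dvd card C"
      \<comment> \<open>Since \<open>v\<close> is nonzero, \<open>c\<close> is determined by
        \<open>y + c *s v\<close>, so a coset is in bijection with the field.\<close>
      using \<open>v \<noteq> 0\<close> by (auto simp: coset_def card_image inj_on_def)
    show "\<forall>C\<in>coset ` S. \<forall>D\<in>coset ` S. C \<noteq> D \<longrightarrow> C \<inter> D = {}"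
      \<comment> \<open>Two cosets with a common element \<open>z\<close> both equal
        \<open>coset z\<close>.\<close>
      using coset_eq by blast
  qed
  then show ?thesis
    by (simp add: union)
\<comment> \<open>An infinite \<open>S\<close> has \<open>card S = 0\<close>, which everything
  divides.\<close>
qed simp

context lie_algebra
begin

lemma bracket_scale_left: "bracket (c *s a) b = c *s bracket a b"
  using module_hom.scale[OF bracket_linear_left[folded module_hom_iff_linear]] .

lemma bracket_scale_right: "bracket a (c *s b) = c *s bracket a b"
  using module_hom.scale[OF bracket_linear_right[folded module_hom_iff_linear]] .

text \<open>A hull has the property that defines it once that property is stable under arbitrary
  intersections.\<close>

lemma lie_subalgebra_generated: "lie_subalgebra (generated_subalgebra S)"
  unfolding generated_subalgebra_def
proof (rule hull_in)
  fix T
  assume "Ball T lie_subalgebra"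
  then show "lie_subalgebra (\<Inter> T)"
    by (auto simp: lie_subalgebra_def intro: subspace_Inter)
qed

lemma generated_subset: "S \<subseteq> generated_subalgebra S"
  by (simp add: generated_subalgebra_def hull_subset)

lemma generated_minimal: "S \<subseteq> H \<Longrightarrow> lie_subalgebra H \<Longrightarrow> generated_subalgebra S \<subseteq> H"
  by (simp add: generated_subalgebra_def hull_minimal)

lemma generated_add_scale_subset:
  "generated_subalgebra {x, y + c *s x} \<subseteq> generated_subalgebra {x, y}"
proof (rule generated_minimal)
  have "subspace (generated_subalgebra {x, y})"
    using lie_subalgebra_generated lie_subalgebra_def by blast
  then show "{x, y + c *s x} \<subseteq> generated_subalgebra {x, y}"
    using generated_subset[of "{x, y}"] by (auto intro: subspace_add subspace_scale)
qed (rule lie_subalgebra_generated)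

lemma generated_add_scale: "generated_subalgebra {x, y + c *s x} = generated_subalgebra {x, y}"
proof
  show "generated_subalgebra {x, y} \<subseteq> generated_subalgebra {x, y + c *s x}"
    \<comment> \<open>Subtracting \<open>c *s x\<close> again recovers \<open>y\<close>, so the
      inclusion already shown also gives its converse.\<close>
    using generated_add_scale_subset[of x "y + c *s x" "- c"] by simp
qed (rule generated_add_scale_subset)

lemma solvabilizer_add_scale: "y \<in> solvabilizer x \<Longrightarrow> y + c *s x \<in> solvabilizer x"
  by (simp add: solvabilizer_def generated_add_scale)

lemma bracket_span_singleton: "a \<in> span {y} \<Longrightarrow> b \<in> span {y} \<Longrightarrow> bracket a b = 0"
  by (auto simp: span_singleton bracket_scale_left bracket_scale_right bracket_alternating)

text \<open>The derived series of an abelian subalgebra reaches zero after one step.\<close>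

lemma solvable_abelian:
  assumes "lie_subalgebra H" and "\<And>a b. a \<in> H \<Longrightarrow> b \<in> H \<Longrightarrow> bracket a b = 0"
  shows "solvable_subalgebra H"
proof -
  have "{bracket a b | a b. a \<in> H \<and> b \<in> H} \<subseteq> {0}"
    using assms(2) by auto
  then have "derived_subalgebra H \<subseteq> {0}"
    unfolding derived_subalgebra_def by (rule span_minimal) (rule subspace_single_0)
  moreover have "0 \<in> derived_subalgebra H"
    unfolding derived_subalgebra_def by (rule span_zero)
  ultimately have "(derived_subalgebra ^^ 1) H = {0}"
    by auto
  then show ?thesis
    using assms(1) unfolding solvable_subalgebra_def by (intro conjI exI)
qed

text \<open>Together with 0, \<open>y\<close> generates a subalgebra inside the line
  \<open>span {y}\<close>, where all brackets vanish.\<close>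

lemma solvabilizer_zero: "solvabilizer 0 = UNIV"
proof -
  have "y \<in> solvabilizer 0" for y
  proof -
    have "lie_subalgebra (span {y})"
      by (simp add: lie_subalgebra_def bracket_span_singleton span_zero)
    then have "generated_subalgebra {0, y} \<subseteq> span {y}"
      by (intro generated_minimal) (auto simp: span_zero span_base)
    then show ?thesis
      unfolding solvabilizer_def
      by (auto intro!: solvable_abelian lie_subalgebra_generated bracket_span_singleton)
  qed
  then show ?thesis by blast
qed

end

theorem corollary3p19:
  fixes scale :: "'f::field \<Rightarrow> 'a::ab_group_add \<Rightarrow> 'a"
    and bracket :: "'a \<Rightarrow> 'a \<Rightarrow> 'a"
    and x :: 'a
    and q :: nat
  assumes "lie_algebra scale bracket"
    and "\<exists>B. finite_dimensional_vector_space scale B"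
    and "(UNIV :: 'a set) \<noteq> {0}"
    and "finite (UNIV :: 'f set)"
    and "card (UNIV :: 'f set) = q"
  shows "q dvd card (lie_algebra.solvabilizer scale bracket x)"
proof -
  interpret lie_algebra scale bracket by fact
  obtain v where "v \<noteq> 0" and "\<And>y c. y \<in> solvabilizer x \<Longrightarrow> y + scale c v \<in> solvabilizer x"
  proof (cases "x = 0")
    case True
    \<comment> \<open>The multiples of \<open>x = 0\<close> form no line, so any nonzero vector
      serves as the direction of translation.\<close>
    from assms(3) obtain v :: 'a where "v \<noteq> 0" by blast
    with True show ?thesis by (intro that[of v]) (simp_all add: solvabilizer_zero)
  next
    case False
    then show ?thesis by (intro that[of x] solvabilizer_add_scale)
  qed
  then show ?thesis
    using card_field_dvd_card_translation_invariant assms(5) by blast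
qed

end
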